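(* Let $p>2$ be a prime. If $A\subseteq \mathbb{F}_p^2$ contains a set of $4$ points, no three of which are collinear, then \[ \underbrace{A+\cdots+A}_{p-1\text{ times}}=\mathbb{F}_p^2. \]
   Context: For sets $A,B$ in an abelian group, $A+B=\{a+b: a\in A, b\in B\}$; iterated sumsets are defined analogously. Collinear means lying on a common affine line in $\mathbb{F}_p^2$. *)

theory Defs
  imports
    "HOL-Analysis.Finite_Cartesian_Product"
    "HOL-Library.Set_Algebras"
    "Berlekamp_Zassenhaus.Finite_Field"
begin

text \<open>
  The prime field of order \<open>p\<close> is \<^typ>\<open>'p::prime_card mod_ring\<close> with \<open>p = CARD('p)\<close>, and the
  plane over it is \<^typ>\<open>('p::prime_card mod_ring)^2\<close>. The library predicate \<open>collinear\<close> is
  confined to real vector spaces, so lines over an arbitrary field are introduced here.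
\<close>

definition affine_line :: "('a::field ^ 'n) set \<Rightarrow> bool" where
  "affine_line L \<longleftrightarrow> (\<exists>a d. d \<noteq> 0 \<and> L = {a + t *s d | t. True})"

definition collinear_points :: "('a::field ^ 'n) set \<Rightarrow> bool" where
  "collinear_points S \<longleftrightarrow> (\<exists>L. affine_line L \<and> S \<subseteq> L)"

end

theory Submission
  imports Defs "HOL-Analysis.Cartesian_Space"
begin

text \<open>
  Four points \<open>q i\<close> in general position carry an affine dependence \<open>l\<close> (coefficients summing to
  \<open>0\<close>) with all coefficients nonzero, and every \<open>v\<close> is a combination of them with
  coefficients \<open>m\<close> summing to \<open>-1\<close>. So \<open>v = (\<Sum>i. (m i + t l i) q i)\<close> for every scalar \<open>t\<close>.
  Lift the four coefficients to residues in \<open>{0..p-1}\<close>: the sum of the lifts is congruent to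
  \<open>-1\<close> modulo \<open>p\<close>, and since each lift runs through all residues as \<open>t\<close> varies, its average over
  \<open>t\<close> is \<open>4 (p - 1) / 2 = 2 p - 2\<close>. Some \<open>t\<close> therefore makes it less than \<open>2 p - 1\<close>, hence equal to
  \<open>p - 1\<close>.
\<close>

definition residue :: "'p::prime_card mod_ring \<Rightarrow> nat" where
  "residue x = nat (to_int_mod_ring x)"

lemma of_nat_residue [simp]: "of_nat (residue x) = (x :: 'p::prime_card mod_ring)"
proof -
  have "0 \<le> to_int_mod_ring x"
    using range_to_int_mod_ring by (metis atLeastLessThan_iff rangeI)
  then have "(of_nat (residue x) :: 'p mod_ring) = of_int (to_int_mod_ring x)"
    by (simp add: residue_def)
  then show ?thesis
    by (simp add: of_int_of_int_mod_ring)
qed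

lemma bij_betw_residue:
  "bij_betw residue (UNIV :: 'p::prime_card mod_ring set) {..<CARD('p)}"
proof -
  have "bij_betw to_int_mod_ring (UNIV :: 'p mod_ring set) {0..<int CARD('p)}"
    by (simp add: bij_betw_def to_int_mod_ring_hom.inj_f range_to_int_mod_ring)
  moreover have "bij_betw nat {0..<int CARD('p)} {..<CARD('p)}"
    by (rule bij_betw_byWitness[where f' = int]) auto
  ultimately have "bij_betw (nat \<circ> to_int_mod_ring) (UNIV :: 'p mod_ring set) {..<CARD('p)}"
    by (rule bij_betw_trans)
  then show ?thesis
    by (simp add: residue_def[abs_def] comp_def)
qed

lemma sum_residue:
  "2 * (\<Sum>x\<in>(UNIV :: 'p::prime_card mod_ring set). residue x) = CARD('p) * (CARD('p) - 1)"
proof -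
  have "(\<Sum>x\<in>(UNIV :: 'p mod_ring set). residue x) = (\<Sum>k<CARD('p). k)"
    by (rule sum.reindex_bij_betw[OF bij_betw_residue])
  moreover have "2 * (\<Sum>k<CARD('p). k) = CARD('p) * (CARD('p) - 1)"
    by (simp add: lessThan_atLeast0 Sum_Ico_nat)
  ultimately show ?thesis
    by simp
qed

text \<open>As \<open>b\<close> is invertible, \<open>t\<close> \<mapsto> \<open>a + t * b\<close>
  permutes the field, so each coefficient has the same total over \<open>t\<close>, whatever
  \<open>a\<close> and \<open>b\<close> are.\<close>

lemma sum_residue_affine:
  fixes a b :: "'p::prime_card mod_ring"
  assumes "b \<noteq> 0"
  shows "(\<Sum>t\<in>UNIV. residue (a + t * b)) = (\<Sum>x\<in>(UNIV :: 'p mod_ring set). residue x)"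
proof (rule sum.reindex_bij_betw)
  show "bij_betw (\<lambda>t. a + t * b) UNIV UNIV"
    by (rule bij_betw_byWitness[where f' = "\<lambda>x. (x - a) / b"]) (use assms in auto)
qed

lemma exists_residues_sum_eq:
  fixes m l :: "'i \<Rightarrow> 'p::prime_card mod_ring"
  assumes fin: "finite I" and card: "card I \<le> 4"
    and l: "\<And>i. i \<in> I \<Longrightarrow> l i \<noteq> 0" "sum l I = 0"
    and m: "sum m I = -1"
  shows "\<exists>t. (\<Sum>i\<in>I. residue (m i + t * l i)) = CARD('p) - 1"
proof -
  define p where "p = CARD('p)"
  define s where "s t = (\<Sum>i\<in>I. residue (m i + t * l i))" for t
  have p: "p \<ge> 2"
    unfolding p_def using prime_card prime_ge_2_nat by blast
  have "2 * sum s UNIV = (\<Sum>i\<in>I. 2 * (\<Sum>t\<in>UNIV. residue (m i + t * l i)))"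
    unfolding s_def by (subst sum.swap) (simp add: sum_distrib_left)
  also have "\<dots> = card I * (p * (p - 1))"
    using l(1) by (simp add: sum_residue_affine sum_residue p_def)
  also have "\<dots> \<le> 4 * (p * (p - 1))"
    using card by simp
  finally have total: "sum s UNIV \<le> p * (2 * p - 2)"
    using p by (simp add: algebra_simps)
  \<comment> \<open>Pigeonhole over the \<open>p\<close> values of \<open>t\<close>: they cannot all
    exceed the mean bound \<open>2 * p - 2\<close>.\<close>
  have "\<exists>t. s t < 2 * p - 1"
  proof (rule ccontr)
    assume "\<nexists>t. s t < 2 * p - 1"
    then have "p * (2 * p - 1) \<le> sum s UNIV"
      using sum_bounded_below[of UNIV "2 * p - 1" s] by (simp add: p_def not_less)
    with total have "p * (2 * p - 1) \<le> p * (2 * p - 2)"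
      by linarith
    with p show False
      by simp
  qed
  then obtain t where t: "s t < 2 * p - 1" ..
  \<comment> \<open>In the field \<open>s t\<close> becomes \<open>sum m I + t * sum l I\<close>,
    that is -1; the successor is taken to state this as divisibility by \<open>p\<close>.\<close>
  have "(of_nat (Suc (s t)) :: 'p mod_ring) = 0"
    using l(2) m by (simp add: s_def sum.distrib flip: sum_distrib_left)
  then have "p dvd Suc (s t)"
    by (simp add: of_nat_eq_0_iff_char_dvd p_def del: of_nat_Suc)
  then obtain k where k: "Suc (s t) = p * k" ..
  \<comment> \<open>The only positive multiple of \<open>p\<close> below \<open>2 * p\<close> is
    \<open>p\<close> itself.\<close>
  with t p have "p * k < p * 2"
    by linarith
  with k have "k = 1"
    by (cases k) auto
  with k have "s t = p - 1"
    by simp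
  then show ?thesis
    unfolding s_def p_def by blast
qed

lemma sumset_add:
  fixes A :: "'a::comm_monoid_add set" and m n :: nat
  shows "(\<Sum>i\<in>{1..m + n}. A) = (\<Sum>i\<in>{1..m}. A) + (\<Sum>i\<in>{1..n}. A)"
  by (induction n) (simp_all add: ac_simps)

lemma of_nat_smult_in_sumset:
  fixes A :: "('a::comm_semiring_1 ^ 'n) set"
  assumes "q \<in> A"
  shows "of_nat n *s q \<in> (\<Sum>i\<in>{1..n}. A)"
proof (induction n)
  case (Suc n)
  then have "q + of_nat n *s q \<in> A + (\<Sum>i\<in>{1..n}. A)"
    using assms by (rule set_plus_intro[rotated])
  then show ?case
    by (simp add: vector_sadd_rdistrib add.commute)
qed simp

text \<open>Repeating each \<open>q i\<close> exactly \<open>w i\<close> times writes the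
  combination as a sum of \<open>sum w I\<close> elements of \<open>A\<close>.\<close>

lemma sum_smult_in_sumset:
  fixes A :: "('a::comm_semiring_1 ^ 'n) set"
  assumes "finite I" "\<And>i. i \<in> I \<Longrightarrow> q i \<in> A"
  shows "(\<Sum>i\<in>I. of_nat (w i) *s q i) \<in> (\<Sum>i\<in>{1..sum w I}. A)"
  using assms
proof (induction I)
  case (insert x I)
  then have "of_nat (w x) *s q x + (\<Sum>i\<in>I. of_nat (w i) *s q i)
      \<in> (\<Sum>i\<in>{1..w x}. A) + (\<Sum>i\<in>{1..sum w I}. A)"
    by (intro set_plus_intro of_nat_smult_in_sumset) auto
  then show ?case
    by (simp only: sum.insert[OF insert.hyps] sumset_add)
qed simp

text \<open>The determinant of the matrix with columns \<open>u\<close> and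
  \<open>v\<close>.\<close>

definition cross2 :: "'a::comm_ring_1 ^ 2 \<Rightarrow> 'a ^ 2 \<Rightarrow> 'a" where
  "cross2 u v = u $ 1 * v $ 2 - u $ 2 * v $ 1"

lemma cross2_nonzero_if_not_collinear:
  fixes a b c :: "'a::field ^ 2"
  assumes "a \<noteq> b" "\<not> collinear_points {a, b, c}"
  shows "cross2 (b - a) (c - a) \<noteq> 0"
proof
  assume *: "cross2 (b - a) (c - a) = 0"
  define d where "d = b - a"
  have d: "d \<noteq> 0"
    using assms by (simp add: d_def)
  \<comment> \<open>The scalar is read off in a coordinate where \<open>d\<close> is nonzero; the
    vanishing determinant makes the other coordinate agree.\<close>
  have "\<exists>t. c = a + t *s d"
  proof (cases "d $ 1 = 0")
    case True
    with d have "d $ 2 \<noteq> 0"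
      by (auto simp: vec_eq_iff forall_2)
    with True * have "c = a + ((c - a) $ 2 / d $ 2) *s d"
      by (auto simp: vec_eq_iff forall_2 cross2_def field_simps simp flip: d_def)
    then show ?thesis ..
  next
    case False
    with * have "c = a + ((c - a) $ 1 / d $ 1) *s d"
      by (auto simp: vec_eq_iff forall_2 cross2_def field_simps simp flip: d_def)
    then show ?thesis ..
  qed
  moreover have "a = a + 0 *s d" "b = a + 1 *s d"
    by (simp_all add: d_def)
  ultimately have "{a, b, c} \<subseteq> {a + t *s d | t. True}"
    by blast
  with d assms(2) show False
    unfolding collinear_points_def affine_line_def by blast
qed

theorem theorem1p3:
  fixes A :: "(('p::prime_card mod_ring) ^ 2) set"
    and p :: nat
  assumes "p = CARD('p)"
    and "p > 2"
    and "\<exists>Q \<subseteq> A. card Q = 4 \<and> (\<forall>T \<subseteq> Q. card T = 3 \<longrightarrow> \<not> collinear_points T)"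
  shows "(\<Sum>i\<in>{1..p - 1}. A) = UNIV"
proof -
  obtain Q where Q: "Q \<subseteq> A" "card Q = 4"
    and general: "\<And>T. T \<subseteq> Q \<Longrightarrow> card T = 3 \<Longrightarrow> \<not> collinear_points T"
    using assms(3) by blast
  obtain a b c d where Q_eq: "Q = {a, b, c, d}"
    and ne: "a \<noteq> b" "a \<noteq> c" "a \<noteq> d" "b \<noteq> c" "b \<noteq> d" "c \<noteq> d"
    using Q(2) by (auto simp: card_Suc_eq numeral_eq_Suc)
  have nz: "cross2 (y - x) (z - x) \<noteq> 0"
    if "x \<in> Q" "y \<in> Q" "z \<in> Q" "x \<noteq> y" "x \<noteq> z" "y \<noteq> z" for x y z
    using that general[of "{x, y, z}"] by (intro cross2_nonzero_if_not_collinear) auto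
  \<comment> \<open>The signed maximal minors of the \<open>3 \<times> 4\<close> matrix with columns \<open>(1, x)\<close>, \<open>x \<in> Q\<close>.\<close>
  define l where "l = (\<lambda>x. if x = a then cross2 (c - b) (d - b)
    else if x = b then - cross2 (c - a) (d - a)
    else if x = c then cross2 (b - a) (d - a)
    else - cross2 (b - a) (c - a))"
  have l_nz: "l x \<noteq> 0" if "x \<in> Q" for x
    using that ne nz by (auto simp: l_def Q_eq)
  \<comment> \<open>This and \<open>l_dep\<close> expand 4 by 4 determinants with a repeated row:
    the row of ones here, a coordinate row there.\<close>
  have l_sum: "sum l Q = 0"
    using ne by (simp add: Q_eq l_def cross2_def algebra_simps)
  have l_dep: "(\<Sum>x\<in>Q. l x *s x) = 0"
  proof -
    have "(\<Sum>x\<in>Q. l x *s x) = l a *s a + l b *s b + l c *s c + l d *s d"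
      using ne by (simp add: Q_eq add.assoc)
    also have "\<dots> = cross2 (c - b) (d - b) *s a - cross2 (c - a) (d - a) *s b
        + cross2 (b - a) (d - a) *s c - cross2 (b - a) (c - a) *s d"
      using ne by (simp add: l_def)
    also have "\<dots> = 0"
      by (simp add: cross2_def vec_eq_iff forall_2 algebra_simps)
    finally show ?thesis .
  qed
  have "v \<in> (\<Sum>i\<in>{1..p - 1}. A)" for v
  proof -
    define D where "D = cross2 (b - a) (c - a)"
    \<comment> \<open>Cramer's rule for \<open>v + a\<close> in the basis \<open>b - a\<close>,
      \<open>c - a\<close>. Expanding around \<open>- a\<close> instead of \<open>a\<close> makes
      the coefficients of \<open>v\<close> sum to -1; \<open>d\<close> gets coefficient 0.\<close>
    define r s where "r = cross2 (v + a) (c - a) / D" and "s = cross2 (b - a) (v + a) / D"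
    define m where "m = (\<lambda>x. if x = a then - 1 - r - s else if x = b then r
      else if x = c then s else 0)"
    have "D \<noteq> 0"
      using nz ne by (simp add: D_def Q_eq)
    then have "v + a = r *s (b - a) + s *s (c - a)"
      by (simp add: vec_eq_iff forall_2 r_def s_def field_simps) (simp add: D_def cross2_def algebra_simps)
    then have v: "v = (- 1 - r - s) *s a + r *s b + s *s c"
      by (simp add: vec_eq_iff forall_2 algebra_simps)
    have m_sum: "sum m Q = -1"
      using ne by (simp add: Q_eq m_def)
    have m_comb: "(\<Sum>x\<in>Q. m x *s x) = v"
      using ne by (subst v) (simp add: Q_eq m_def algebra_simps)
    obtain t where t: "(\<Sum>x\<in>Q. residue (m x + t * l x)) = p - 1"
      using exists_residues_sum_eq[OF _ _ l_nz l_sum m_sum] Q(2) assms(1)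
      by (auto simp: Q_eq)
    \<comment> \<open>Casting the lifts back to the field recovers the coefficients, so these
      natural weights of total \<open>p - 1\<close> represent \<open>v\<close>.\<close>
    have "(\<Sum>x\<in>Q. of_nat (residue (m x + t * l x)) *s x)
        = (\<Sum>x\<in>Q. m x *s x) + t *s (\<Sum>x\<in>Q. l x *s x)"
      by (simp add: vec_eq_iff sum_distrib_left sum.distrib algebra_simps)
    also have "\<dots> = v"
      by (simp add: m_comb l_dep)
    finally show ?thesis
      using sum_smult_in_sumset[of Q "\<lambda>x. x" A "\<lambda>x. residue (m x + t * l x)"] Q t
      by (auto simp: Q_eq)
  qed
  then show ?thesis
    by blast
qed

end
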